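(* Let $f\in\mathcal{A}_1$ be strongly spirallike, i.e. there exist $\lambda\in(-\pi/2,\pi/2)$ and $\alpha\in(0,1)$ such that $|\operatorname{Arg}(zf'(z)/f(z))-\lambda|<\pi\alpha/2$ for all $z\in\mathbb{D}$. Then $\operatorname{Log}(f(z)/z)$ is bounded on $\mathbb{D}$. In particular, $f$ is bounded on $\mathbb{D}$. *)

theory Defs
  imports "HOL-Analysis.Analysis"
begin

definition class_A1 :: "(complex \<Rightarrow> complex) \<Rightarrow> bool" where
  "class_A1 f \<longleftrightarrow> f holomorphic_on ball 0 1 \<and> f 0 = 0 \<and> deriv f 0 = 1"

text \<open>The quotient z f'(z) / f(z), extended by its limit value 1 at z = 0.\<close>
definition spiral_quot :: "(complex \<Rightarrow> complex) \<Rightarrow> complex \<Rightarrow> complex" where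
  "spiral_quot f z = (if z = 0 then 1 else z * deriv f z / f z)"

text \<open>Strongly spirallike: f(z) \<noteq> 0 for z \<noteq> 0 in the disk (so that the quotient is defined),
  and there are \<lambda> in (-pi/2, pi/2), \<alpha> in (0,1) with |Arg(z f'/f) - \<lambda>| < pi \<alpha> / 2 on the disk.\<close>
definition strongly_spirallike :: "(complex \<Rightarrow> complex) \<Rightarrow> bool" where
  "strongly_spirallike f \<longleftrightarrow>
     (\<forall>z\<in>ball 0 1. z \<noteq> 0 \<longrightarrow> f z \<noteq> 0) \<and>
     (\<exists>lam alpha::real. -pi/2 < lam \<and> lam < pi/2 \<and> 0 < alpha \<and> alpha < 1 \<and>
        (\<forall>z\<in>ball 0 1. \<bar>Arg (spiral_quot f z) - lam\<bar> < pi * alpha / 2))"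

end

theory Submission
  imports Defs "HOL-Complex_Analysis.Complex_Analysis"
begin

text \<open>
  The function \<open>p(z) = z f'(z) / f(z)\<close> maps the disk into a sector of opening \<open>\<pi>\<alpha>\<close>,
  so a rotation of \<open>p\<close> raised to the power \<open>1/\<alpha>\<close> has positive real part.
  The Schwarz lemma then gives \<open>|p(z)| \<le> ((1+|z|)/(1-|z|))^\<alpha>\<close>. Since
  the derivative of \<open>log (f(z)/z)\<close> is \<open>(p(z)-1)/z\<close> and
  \<open>(1-r)^(-\<alpha>)\<close> is integrable on \<open>[0,1)\<close> for \<open>\<alpha> < 1\<close>, integration along radii bounds
  the logarithm.
\<close>

section \<open>Growth of functions with values in a half-plane or a sector\<close>

text \<open>This Cayley transform carries the right half-plane into the unit disk and
  \<open>a\<close> to the origin, which prepares the Schwarz lemma.\<close>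

lemma norm_cayley_less_1:
  fixes w a :: complex
  assumes "Re w > 0" "Re a > 0"
  shows "norm ((w - a) / (w + cnj a)) < 1"
proof -
  have "(norm (w + cnj a))\<^sup>2 - (norm (w - a))\<^sup>2 = 4 * (Re w * Re a)"
    unfolding cmod_power2 by (simp add: power2_eq_square algebra_simps)
  moreover have "Re w * Re a > 0" using assms by simp
  ultimately have "(norm (w - a))\<^sup>2 < (norm (w + cnj a))\<^sup>2" by linarith
  then have "norm (w - a) < norm (w + cnj a)"
    by (rule power2_less_imp_less) simp
  then show ?thesis
    by (metis divide_less_eq_1 norm_divide norm_ge_zero order_le_less_trans)
qed

text \<open>The Schwarz lemma applies to the Cayley transform of \<open>h\<close> centred at
  \<open>h 0\<close>; the triangle inequality turns its conclusion into a linear inequality that is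
  solved for \<open>norm (h z)\<close>.\<close>

lemma norm_le_of_Re_pos:
  assumes hol: "h holomorphic_on ball 0 1"
    and pos: "\<And>z. z \<in> ball 0 1 \<Longrightarrow> Re (h z) > 0"
    and z: "z \<in> ball 0 1"
  shows "norm (h z) \<le> norm (h 0) * ((1 + norm z) / (1 - norm z))"
proof -
  define w where "w = (\<lambda>z. (h z - h 0) / (h z + cnj (h 0)))"
  have pos0: "Re (h 0) > 0" using pos by simp
  have nz: "h u + cnj (h 0) \<noteq> 0" if "u \<in> ball 0 1" for u
    using pos[OF that] pos0 by (auto simp: complex_eq_iff)
  have "w holomorphic_on ball 0 1"
    unfolding w_def using nz by (intro holomorphic_intros hol) auto
  moreover have "norm (w u) < 1" if "norm u < 1" for u
    unfolding w_def using pos0 pos[of u] that by (intro norm_cayley_less_1) auto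
  ultimately have "norm (w z) \<le> norm z"
    using z by (intro Schwarz_Lemma) (auto simp: w_def)
  then have "norm (h z - h 0) \<le> norm z * norm (h z + cnj (h 0))"
    using nz[OF z] by (simp add: w_def norm_divide field_simps)
  also have "\<dots> \<le> norm z * (norm (h z) + norm (h 0))"
    using norm_triangle_ineq[of "h z" "cnj (h 0)"] by (intro mult_left_mono) auto
  finally have "norm (h z) - norm (h 0) \<le> norm z * (norm (h z) + norm (h 0))"
    using norm_triangle_ineq2[of "h z" "h 0"] by linarith
  then show ?thesis using z by (simp add: field_simps)
qed

text \<open>The power \<open>1/a\<close> opens the sector to the right half-plane; raising the
  half-plane estimate to the power \<open>a\<close> returns to \<open>q\<close>.\<close>

lemma norm_le_of_sector:
  assumes hol: "q holomorphic_on ball 0 1"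
    and nz: "\<And>z. z \<in> ball 0 1 \<Longrightarrow> q z \<noteq> 0"
    and arg: "\<And>z. z \<in> ball 0 1 \<Longrightarrow> \<bar>Arg (q z)\<bar> < pi * a / 2"
    and a: "0 < a" "a < 1" and z: "z \<in> ball 0 1"
  shows "norm (q z) \<le> norm (q 0) * ((1 + norm z) / (1 - norm z)) powr a"
proof -
  \<comment> \<open>The principal branch of the power \<open>1/a\<close>; it is holomorphic because
    \<open>q\<close> avoids the branch cut.\<close>
  define h where "h = (\<lambda>z. exp (Ln (q z) / of_real a))"
  have notneg: "q u \<notin> \<real>\<^sub>\<le>\<^sub>0" if u: "u \<in> ball 0 1" for u
  proof
    assume "q u \<in> \<real>\<^sub>\<le>\<^sub>0"
    then obtain r where r: "q u = of_real r" "r \<le> 0" by (auto elim: nonpos_Reals_cases)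
    then have "Arg (q u) = pi" using nz[OF u] by (auto simp: Arg_of_real)
    moreover have "pi * a \<le> pi * 1" using a by (intro mult_left_mono) auto
    ultimately show False using arg[OF u] pi_gt_zero by auto
  qed
  have "h holomorphic_on ball 0 1"
    unfolding h_def using notneg a by (intro holomorphic_intros hol) auto
  moreover have "Re (h u) > 0" if u: "u \<in> ball 0 1" for u
  proof -
    have "\<bar>Im (Ln (q u)) / a\<bar> < pi / 2"
      using arg[OF u] a nz[OF u] by (simp add: Arg_eq_Im_Ln field_simps)
    then have "cos (Im (Ln (q u)) / a) > 0"
      by (intro cos_gt_zero_pi) linarith+
    then show ?thesis by (simp add: h_def Re_exp)
  qed
  ultimately have *: "norm (h z) \<le> norm (h 0) * ((1 + norm z) / (1 - norm z))"
    using z by (intro norm_le_of_Re_pos)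
  have norm_h: "norm (h u) powr a = norm (q u)" if "u \<in> ball 0 1" for u
    using nz[OF that] a by (simp add: h_def powr_def)
  have "norm (q z) = norm (h z) powr a" using norm_h z by simp
  also have "\<dots> \<le> (norm (h 0) * ((1 + norm z) / (1 - norm z))) powr a"
    using * a by (intro powr_mono2) auto
  also have "\<dots> = norm (q 0) * ((1 + norm z) / (1 - norm z)) powr a"
    using z norm_h[of 0] by (subst powr_mult) auto
  finally show ?thesis .
qed

text \<open>Along the radius to \<open>z\<close> the majorant of the derivative has an explicit
  antiderivative, whose increment stays bounded up to the circle because the exponent
  \<open>1 - a\<close> is positive.\<close>

lemma norm_le_of_deriv_growth:
  assumes hol: "g holomorphic_on ball 0 1"
    and bnd: "\<And>z. z \<in> ball 0 1 \<Longrightarrow> norm (deriv g z) \<le> C * (1 - norm z) powr (-a)"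
    and a: "a < 1" and z: "z \<in> ball 0 1"
  shows "norm (g z - g 0) \<le> C / (1 - a)"
proof -
  define r where "r = norm z"
  have r: "0 \<le> r" "r < 1" using z by (auto simp: r_def)
  have C: "C \<ge> 0" using bnd[of 0] norm_ge_zero[of "deriv g 0"] by (simp del: norm_ge_zero)
  \<comment> \<open>An antiderivative of \<open>C * r * (1 - t * r) powr (-a)\<close>, which
    dominates the speed of \<open>t\<close> \<mapsto> \<open>g (t * z)\<close>.\<close>
  define \<phi> where "\<phi> = (\<lambda>t. - C / (1 - a) * (1 - t * r) powr (1 - a))"
  have tr: "1 - t * r > 0" if "0 \<le> t" "t \<le> 1" for t
    using mult_left_le_one_le[of r t] r that by linarith
  have tz: "of_real t * z \<in> ball 0 1" if "0 \<le> t" "t \<le> 1" for t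
    using tr[OF that] that by (simp add: norm_mult r_def)
  have dg: "((\<lambda>t. g (of_real t * z)) has_vector_derivative z * deriv g (of_real t * z)) (at t)"
    if "0 \<le> t" "t \<le> 1" for t
  proof -
    have "(g has_field_derivative deriv g (of_real t * z)) (at (of_real t * z))"
      using hol tz[OF that] by (intro holomorphic_derivI) auto
    moreover have "((\<lambda>t. of_real t * z) has_vector_derivative z) (at t)"
      by (auto intro!: derivative_eq_intros)
    ultimately show ?thesis
      using field_vector_diff_chain_at by (fastforce simp: o_def)
  qed
  have dphi: "(\<phi> has_vector_derivative C * r * (1 - t * r) powr (-a)) (at t)"
    if "0 \<le> t" "t \<le> 1" for t
  proof -
    have "((\<lambda>t. (1 - t * r) powr (1 - a)) has_real_derivative
        (1 - a) * (1 - t * r) powr (1 - a - 1) * (- r)) (at t)"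
      using tr[OF that]
      by (intro DERIV_chain2[OF has_real_derivative_powr]) (auto intro!: derivative_eq_intros)
    then have "(\<phi> has_real_derivative
        - C / (1 - a) * ((1 - a) * (1 - t * r) powr (1 - a - 1) * (- r))) (at t)"
      unfolding \<phi>_def by (rule DERIV_cmult)
    then show ?thesis
      using a by (simp add: has_real_derivative_iff_has_vector_derivative mult_ac)
  qed
  have "norm (g (of_real 1 * z) - g (of_real 0 * z)) \<le> \<phi> 1 - \<phi> 0"
  proof (rule differentiable_bound_general[where f = "\<lambda>t. g (of_real t * z)"])
    show "continuous_on {0..1} (\<lambda>t. g (of_real t * z))"
      by (intro continuous_at_imp_continuous_on ballI has_vector_derivative_continuous[OF dg]) auto
    show "continuous_on {0..1} \<phi>"
      by (intro continuous_at_imp_continuous_on ballI has_vector_derivative_continuous[OF dphi]) auto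
    show "norm (z * deriv g (of_real t * z)) \<le> C * r * (1 - t * r) powr (-a)"
      if "0 < t" "t < 1" for t
    proof -
      have "norm (deriv g (of_real t * z)) \<le> C * (1 - t * r) powr (-a)"
        using bnd[OF tz[of t]] that by (simp add: norm_mult r_def)
      then have "r * norm (deriv g (of_real t * z)) \<le> r * (C * (1 - t * r) powr (-a))"
        using r by (intro mult_left_mono) auto
      then show ?thesis by (simp add: norm_mult r_def mult_ac)
    qed
  qed (use dg dphi in auto)
  also have "\<phi> 1 - \<phi> 0 = C / (1 - a) - C / (1 - a) * (1 - r) powr (1 - a)"
    by (simp add: \<phi>_def)
  also have "\<dots> \<le> C / (1 - a)" using C a by simp
  finally show ?thesis by simp
qed

section \<open>Excluding zeros and rotating the sector\<close>

text \<open>By the open mapping theorem a zero would put a whole disk around 0 into the image,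
  including negative reals such as \<open>- e / 2\<close>.\<close>

lemma nonzero_of_Re_pos_off_zero:
  assumes hol: "q holomorphic_on S" and S: "open S" "connected S"
    and nc: "\<not> q constant_on S"
    and pos: "\<And>z. z \<in> S \<Longrightarrow> q z \<noteq> 0 \<Longrightarrow> Re (q z) > 0"
    and z: "z \<in> S"
  shows "q z \<noteq> 0"
proof
  assume "q z = 0"
  then have "0 \<in> q ` S" using z by force
  moreover have "open (q ` S)"
    using open_mapping_thm[OF hol S S(1) _ nc] by simp
  ultimately obtain e where e: "e > 0" "ball 0 e \<subseteq> q ` S"
    by (auto simp: open_contains_ball)
  then have "complex_of_real (- e / 2) \<in> q ` S" by (intro subsetD[OF e(2)]) auto
  then obtain u where "u \<in> S" "q u = of_real (- e / 2)" by (metis imageE)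
  then show False using pos[of u] e by auto
qed

text \<open>The bound keeps \<open>Arg w - t\<close> in the principal range, so no multiple of 2 pi
  enters.\<close>

lemma Arg_rotate_bounded:
  assumes "w \<noteq> 0" "\<bar>Arg w - t\<bar> < pi"
  shows "Arg (cis (- t) * w) = Arg w - t"
proof -
  have "cis (- t) * w = of_real (norm w) * exp (\<i> * of_real (Arg w - t))"
    using rcis_cmod_Arg[of w]
    by (metis (no_types, lifting) cis_conv_exp cis_mult diff_conv_add_uminus mult.left_commute mult.commute rcis_def)
  then show ?thesis
    using assms by (intro Arg_unique[of "norm w"]) auto
qed

section \<open>The quotient f(z)/z and its logarithmic derivative\<close>

context
  fixes f F :: "complex \<Rightarrow> complex"
  assumes f: "class_A1 f" and nz: "\<And>z. z \<in> ball 0 1 \<Longrightarrow> z \<noteq> 0 \<Longrightarrow> f z \<noteq> 0"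
  defines "F \<equiv> (\<lambda>z. if z = 0 then 1 else f z / z)"
begin

text \<open>The singularity at 0 is removable, with limit \<open>deriv f 0\<close>, which is
  1.\<close>

lemma quotient_holomorphic: "F holomorphic_on ball 0 1"
  using pole_lemma[of f "ball 0 1" 0] f by (simp add: class_A1_def F_def cong: if_cong)

lemma quotient_nonzero: "z \<in> ball 0 1 \<Longrightarrow> F z \<noteq> 0"
  using nz by (simp add: F_def)

text \<open>Writing the function as \<open>deriv f z / F z\<close> absorbs the exceptional value at
  0, since the denominator has no zeros in the disk.\<close>

lemma spiral_quot_holomorphic: "spiral_quot f holomorphic_on ball 0 1"
proof -
  have "(\<lambda>z. deriv f z / F z) holomorphic_on ball 0 1"
    using f quotient_nonzero
    by (intro holomorphic_intros quotient_holomorphic holomorphic_deriv) (auto simp: class_A1_def)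
  moreover have "deriv f z / F z = spiral_quot f z" for z
    using f by (simp add: F_def spiral_quot_def class_A1_def)
  ultimately show ?thesis by simp
qed

lemma deriv_quotient:
  assumes z: "z \<in> ball 0 1" "z \<noteq> 0"
  shows "deriv F z / F z = (spiral_quot f z - 1) / z"
proof -
  have "(f has_field_derivative deriv f z) (at z)"
    using f z by (intro holomorphic_derivI[of f "ball 0 1"]) (auto simp: class_A1_def)
  then have "((\<lambda>z. f z / z) has_field_derivative (deriv f z * z - f z) / z\<^sup>2) (at z)"
    using z by (auto intro!: derivative_eq_intros simp: power2_eq_square)
  then have "(F has_field_derivative (deriv f z * z - f z) / z\<^sup>2) (at z)"
    by (rule has_field_derivative_transform_within_open[where S = "- {0}"])
      (use z in \<open>auto simp: F_def\<close>)
  then show ?thesis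
    using z nz[OF z]
    by (auto simp: DERIV_imp_deriv F_def spiral_quot_def field_simps power2_eq_square)
qed

end

text \<open>Rotation by \<open>- t\<close> centres the sector on the positive axis without changing
  norms; the value 1 at the origin makes the constant in the sector estimate 1.\<close>

lemma spiral_quot_growth:
  assumes f: "class_A1 f" and nz: "\<And>z. z \<in> ball 0 1 \<Longrightarrow> z \<noteq> 0 \<Longrightarrow> f z \<noteq> 0"
    and a: "0 < a" "a < 1"
    and arg: "\<And>z. z \<in> ball 0 1 \<Longrightarrow> \<bar>Arg (spiral_quot f z) - t\<bar> < pi * a / 2"
    and z: "z \<in> ball 0 1"
  shows "norm (spiral_quot f z) \<le> ((1 + norm z) / (1 - norm z)) powr a"
proof -
  define q where "q = (\<lambda>z. cis (- t) * spiral_quot f z)"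
  have hol: "q holomorphic_on ball 0 1"
    unfolding q_def using spiral_quot_holomorphic[OF f nz] by (intro holomorphic_intros)
  have "pi * a < pi * 1" using a by (intro mult_strict_left_mono) auto
  then have lt: "pi * a / 2 < pi / 2" by simp
  have q0: "norm (q 0) = 1" by (simp add: q_def norm_mult spiral_quot_def)
  have Arg_q: "\<bar>Arg (q u)\<bar> < pi * a / 2" if "u \<in> ball 0 1" "q u \<noteq> 0" for u
  proof -
    have "\<bar>Arg (spiral_quot f u) - t\<bar> < pi"
      using arg[OF that(1)] lt pi_gt_zero by linarith
    then show ?thesis
      using arg[OF that(1)] that(2) by (simp add: q_def Arg_rotate_bounded)
  qed
  have pos: "Re (q u) > 0" if "u \<in> ball 0 1" "q u \<noteq> 0" for u
    using Arg_q[OF that] lt that(2) Arg_Re_pos[of "q u"] by linarith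
  \<comment> \<open>As \<open>Arg 0 = 0\<close>, the sector condition alone does not exclude zeros.\<close>
  have qnz: "q u \<noteq> 0" if u: "u \<in> ball 0 1" for u
  proof (cases "q constant_on ball 0 1")
    case True
    then have "q u = q 0" using u unfolding constant_on_def by (metis centre_in_ball zero_less_one)
    then show ?thesis using q0 by auto
  next
    case False
    then show ?thesis using nonzero_of_Re_pos_off_zero[OF hol _ _ False pos u] by auto
  qed
  have "norm (q z) \<le> norm (q 0) * ((1 + norm z) / (1 - norm z)) powr a"
    using hol qnz Arg_q a z by (intro norm_le_of_sector) auto
  then show ?thesis by (simp add: q0) (simp add: q_def norm_mult)
qed

section \<open>Boundedness of the logarithm and of f\<close>

theorem theorem2:
  fixes f :: "complex \<Rightarrow> complex"
  assumes "class_A1 f" and "strongly_spirallike f"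
  shows "(\<exists>g. g holomorphic_on ball 0 1 \<and> g 0 = 0 \<and>
            (\<forall>z\<in>ball 0 1 - {0}. exp (g z) = f z / z) \<and> bounded (g ` ball 0 1))
         \<and> bounded (f ` ball 0 1)"
proof -
  have nz: "\<And>z. z \<in> ball 0 1 \<Longrightarrow> z \<noteq> 0 \<Longrightarrow> f z \<noteq> 0"
    using assms(2) by (auto simp: strongly_spirallike_def)
  obtain t a :: real where a: "0 < a" "a < 1"
    and arg: "\<And>z. z \<in> ball 0 1 \<Longrightarrow> \<bar>Arg (spiral_quot f z) - t\<bar> < pi * a / 2"
    using assms(2) unfolding strongly_spirallike_def by blast
  define F where "F = (\<lambda>z. if z = 0 then 1 else f z / z)"
  have Fhol: "F holomorphic_on ball 0 1" and Fnz: "\<And>z. z \<in> ball 0 1 \<Longrightarrow> F z \<noteq> 0"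
    using quotient_holomorphic[OF assms(1) nz] quotient_nonzero[OF assms(1) nz]
    by (auto simp: F_def)
  obtain g0 where g0: "g0 holomorphic_on ball 0 1" "\<And>z. z \<in> ball 0 1 \<Longrightarrow> F z = exp (g0 z)"
    using contractible_imp_holomorphic_log[OF Fhol] Fnz
    by (metis convex_imp_contractible convex_ball)
  \<comment> \<open>Normalises the logarithm to vanish at 0; as \<open>F 0 = 1\<close>, it remains a
    logarithm of \<open>F\<close>.\<close>
  define g where "g = (\<lambda>z. g0 z - g0 0)"
  have "exp (g0 0) = 1" using g0(2)[of 0] by (simp add: F_def)
  then have expg: "exp (g z) = F z" if "z \<in> ball 0 1" for z
    using g0(2)[OF that] by (simp add: g_def exp_diff)
  have ghol: "g holomorphic_on ball 0 1"
    unfolding g_def by (intro holomorphic_intros g0)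
  have gderiv: "deriv g z = deriv F z / F z" if z: "z \<in> ball 0 1" for z
  proof -
    have "(g has_field_derivative deriv g z) (at z)"
      using ghol z by (intro holomorphic_derivI) auto
    then have "((\<lambda>z. exp (g z)) has_field_derivative F z * deriv g z) (at z)"
      using expg[OF z] by (auto intro!: derivative_eq_intros)
    then have "(F has_field_derivative F z * deriv g z) (at z)"
      by (rule has_field_derivative_transform_within_open[where S = "ball 0 1"])
        (use z expg in auto)
    then show ?thesis using Fnz[OF z] by (simp add: DERIV_imp_deriv)
  qed
  \<comment> \<open>The formula for \<open>deriv g\<close> divides by \<open>z\<close>, so near 0
    compactness supplies the bound instead.\<close>
  have "compact (deriv g ` cball 0 (1/2))"
    using ghol
    by (intro compact_continuous_image holomorphic_on_imp_continuous_on
        holomorphic_on_subset[OF holomorphic_deriv[of g "ball 0 1"]]) auto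
  then obtain M where M: "\<And>z. z \<in> cball 0 (1/2) \<Longrightarrow> norm (deriv g z) \<le> M"
    by (metis bounded_iff compact_imp_bounded imageI)
  \<comment> \<open>For \<open>norm z > 1/2\<close> the constant 6 arises as (2 + 1) / (1/2): 2
    bounds \<open>(1 + norm z) powr a\<close>, 1 comes from subtracting 1, and 1/2 bounds the
    denominator from below.\<close>
  define C where "C = max M 6"
  have growth: "norm (deriv g z) \<le> C * (1 - norm z) powr (-a)" if z: "z \<in> ball 0 1" for z
  proof -
    \<comment> \<open>Lets additive constants be absorbed into the singular factor.\<close>
    have ge1: "1 \<le> (1 - norm z) powr (-a)"
    proof -
      have "(1 - norm z) powr a \<le> 1" using z a by (intro powr_le1) auto
      then show ?thesis using z by (simp add: powr_minus field_simps)
    qed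
    show ?thesis
    proof (cases "norm z \<le> 1/2")
      case True
      then have "norm (deriv g z) \<le> C" using M[of z] by (auto simp: C_def)
      also have "\<dots> \<le> C * (1 - norm z) powr (-a)"
        using ge1 mult_left_mono[of 1 "(1 - norm z) powr (-a)" C] by (simp add: C_def)
      finally show ?thesis .
    next
      case False
      then have "z \<noteq> 0" by auto
      have "norm (spiral_quot f z) \<le> ((1 + norm z) / (1 - norm z)) powr a"
        by (rule spiral_quot_growth[OF assms(1) nz a arg z])
      also have "\<dots> = (1 + norm z) powr a * (1 - norm z) powr (-a)"
        using z by (simp add: powr_divide powr_minus divide_simps)
      also have "\<dots> \<le> 2 * (1 - norm z) powr (-a)"
      proof (intro mult_right_mono)
        have "(1 + norm z) powr a \<le> (1 + norm z) powr 1" using a by (intro powr_mono) auto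
        then show "(1 + norm z) powr a \<le> 2" using z by simp
      qed auto
      finally have p: "norm (spiral_quot f z - 1) \<le> 3 * (1 - norm z) powr (-a)"
        using ge1 norm_triangle_ineq4[of "spiral_quot f z" 1] by simp
      have "norm (deriv g z) = norm (spiral_quot f z - 1) / norm z"
        using gderiv[OF z] deriv_quotient[OF assms(1) nz z \<open>z \<noteq> 0\<close>]
        by (simp add: F_def norm_divide)
      also have "\<dots> \<le> 3 * (1 - norm z) powr (-a) / (1/2)"
        using p False by (intro frac_le) auto
      also have "\<dots> = 6 * (1 - norm z) powr (-a)" by simp
      also have "\<dots> \<le> C * (1 - norm z) powr (-a)"
        by (intro mult_right_mono) (auto simp: C_def)
      finally show ?thesis .
    qed
  qed
  define B where "B = C / (1 - a)"
  have g_0: "g 0 = 0" by (simp add: g_def)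
  have gB: "norm (g z) \<le> B" if "z \<in> ball 0 1" for z
    using norm_le_of_deriv_growth[OF ghol growth a(2) that] by (simp add: g_0 B_def)
  have "norm (f z) \<le> exp B" if z: "z \<in> ball 0 1" for z
  proof -
    have "f z = z * exp (g z)"
      using expg[OF z] assms(1) by (auto simp: F_def class_A1_def)
    then have "norm (f z) = norm z * exp (Re (g z))" by (simp add: norm_mult)
    also have "\<dots> \<le> 1 * exp B"
      using z gB[OF z] complex_Re_le_cmod[of "g z"] by (intro mult_mono) auto
    finally show ?thesis by simp
  qed
  then have "bounded (f ` ball 0 1)" unfolding bounded_iff by blast
  moreover have "bounded (g ` ball 0 1)" using gB unfolding bounded_iff by blast
  moreover have "\<forall>z\<in>ball 0 1 - {0}. exp (g z) = f z / z"
    using expg by (simp add: F_def)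
  ultimately show ?thesis using ghol g_0 by blast
qed

end
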